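(* Let $G\le O_n(\mathbb{R})$ be finite. Then $G$ admits an exact fundamental domain $F$ with $|F\cap O|=1$ for every $G$-orbit $O\subseteq\mathbb{R}^n$ if and only if $G$ is a reflection group.
   Context: A subset $F\subseteq\mathbb{R}^n$ is a fundamental domain for $G$ if (1) $F$ is closed and convex, (2) the sets $\mathrm{int}(gF)$, $g\in G$, are pairwise disjoint, and (3) $\mathbb{R}^n=\bigcup_{g\in G} gF$; such $F$ is a polyhedral cone. $F$ is exact if for every facet $S$ of $F$ there is $g\in G$ with $S=F\cap gF$. A $G$-orbit is a set $\{gx:g\in G\}$ for some $x\in\mathbb{R}^n$. A reflection group is a group generated by orthogonal reflections in hyperplanes through the origin. *)

theory Defs
  imports "HOL-Algebra.Generated_Groups" "HOL-Analysis.Analysis"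
begin

definition orthogonal_group :: "(real^'n^'n) monoid" where
  "orthogonal_group = \<lparr>carrier = {A. orthogonal_matrix A}, monoid.mult = (**), one = mat 1\<rparr>"

lemma group_orthogonal_group: "Group.group (orthogonal_group :: (real^'n^'n) monoid)"
proof (rule groupI)
  fix A :: "real^'n^'n"
  assume "A \<in> carrier orthogonal_group"
  then show "\<exists>B\<in>carrier orthogonal_group. B \<otimes>\<^bsub>orthogonal_group\<^esub> A = \<one>\<^bsub>orthogonal_group\<^esub>"
    by (intro bexI[of _ "Finite_Cartesian_Product.transpose A"])
      (auto simp: orthogonal_group_def orthogonal_matrix_def)
qed (auto simp: orthogonal_group_def orthogonal_matrix_mul orthogonal_matrix_id matrix_mul_assoc)

text \<open>The orthogonal reflection in the hyperplane \<open>{x. v \<bullet> x = 0}\<close>, for \<open>v \<noteq> 0\<close>.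
  (For \<open>v = 0\<close> the formula yields the identity, which is why that case is excluded below.)\<close>

definition hyperplane_reflection :: "real^'n \<Rightarrow> real^'n \<Rightarrow> real^'n" where
  "hyperplane_reflection v x = x - (2 * (v \<bullet> x) / (v \<bullet> v)) *\<^sub>R v"

definition reflections :: "(real^'n^'n) set" where
  "reflections = {matrix (hyperplane_reflection v) | v. v \<noteq> 0}"

definition reflection_group :: "(real^'n^'n) set \<Rightarrow> bool" where
  "reflection_group G \<longleftrightarrow> (\<exists>R \<subseteq> reflections. G = generate orthogonal_group R)"

definition translate :: "real^'n^'n \<Rightarrow> (real^'n) set \<Rightarrow> (real^'n) set" where
  "translate g F = (\<lambda>x. g *v x) ` F"

definition fundamental_domain :: "(real^'n^'n) set \<Rightarrow> (real^'n) set \<Rightarrow> bool" where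
  "fundamental_domain G F \<longleftrightarrow>
     closed F \<and> convex F \<and>
     disjoint_family_on (\<lambda>g. interior (translate g F)) G \<and>
     (\<Union>g\<in>G. translate g F) = UNIV"

definition exact_fundamental_domain :: "(real^'n^'n) set \<Rightarrow> (real^'n) set \<Rightarrow> bool" where
  "exact_fundamental_domain G F \<longleftrightarrow>
     fundamental_domain G F \<and> (\<forall>S. S facet_of F \<longrightarrow> (\<exists>g\<in>G. S = F \<inter> translate g F))"

definition orbits :: "(real^'n^'n) set \<Rightarrow> (real^'n) set set" where
  "orbits G = {{g *v x | g. g \<in> G} | x. True}"

end

theory Submission
  imports Defs
begin

text \<open>
  \<^emph>\<open>From a domain to reflections.\<close> Separating \<open>F\<close> from its translates shows that \<open>F\<close> is a
  polyhedron. If \<open>S = F \<inter> g F\<close> is a facet, a point \<open>x\<close> of \<open>S\<close> and \<open>g\<^sup>-\<^sup>1 x\<close> both lie in \<open>F\<close> and in one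
  orbit, so \<open>g\<close> fixes \<open>S\<close> pointwise and is the reflection in the hyperplane spanned by \<open>S\<close>. Let \<open>W\<close> be
  generated by the reflections in \<open>G\<close>, and let \<open>p\<close> be interior to \<open>F\<close>. If \<open>w \<in> W\<close> maximises
  \<open>w g p \<bullet> p\<close>, no facet reflection can increase this product, so \<open>w g p \<in> F\<close>; hence \<open>w g p = p\<close>,
  and \<open>w g = 1\<close> because the interiors of the translates are disjoint.

  \<^emph>\<open>From reflections to a domain.\<close> \<open>F\<close> is the chamber of a point \<open>p\<close> off all mirrors of reflections in
  \<open>G\<close>. That an orbit meets it at most once follows by induction on the length of a word in simple
  reflections: if the last letter \<open>a\<close> is sent to a negative root by the word, then the
  point lies on the mirror of \<open>a\<close> and the letter can be dropped; otherwise the deletion property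
  shortens the word.
\<close>

section \<open>Hyperplane reflections\<close>

lemma linear_hyperplane_reflection: "linear (hyperplane_reflection v)"
  by (rule linearI)
    (simp_all add: hyperplane_reflection_def inner_add_right algebra_simps add_divide_distrib)

lemma matrix_hyperplane_reflection:
  "matrix (hyperplane_reflection v) *v x = hyperplane_reflection v x"
  by (simp add: matrix_works linear_hyperplane_reflection)

lemma hyperplane_reflection_unit:
  "norm v = 1 \<Longrightarrow> hyperplane_reflection v x = x - (2 * (v \<bullet> x)) *\<^sub>R v"
  by (simp add: hyperplane_reflection_def norm_eq_1)

lemma hyperplane_reflection_scale:
  "c \<noteq> 0 \<Longrightarrow> hyperplane_reflection (c *\<^sub>R v) = hyperplane_reflection v"
  by (rule ext) (simp add: hyperplane_reflection_def)

lemma hyperplane_reflection_minus: "hyperplane_reflection (- v) = hyperplane_reflection v"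
  using hyperplane_reflection_scale[of "- 1" v] by simp

lemma hyperplane_reflection_self: "hyperplane_reflection v v = - v"
  by (cases "v = 0") (simp_all add: hyperplane_reflection_def algebra_simps scaleR_2)

lemma hyperplane_reflection_orthogonal: "v \<bullet> x = 0 \<Longrightarrow> hyperplane_reflection v x = x"
  by (simp add: hyperplane_reflection_def)

lemma hyperplane_reflection_involutive: "hyperplane_reflection v (hyperplane_reflection v x) = x"
  by (cases "v = 0") (simp_all add: hyperplane_reflection_def algebra_simps)

lemma inner_hyperplane_reflection:
  "hyperplane_reflection v x \<bullet> hyperplane_reflection v y = x \<bullet> y"
  by (cases "v = 0")
    (simp_all add: hyperplane_reflection_def inner_diff_left inner_diff_right field_simps inner_commute)

lemma inner_hyperplane_reflection_left:
  "hyperplane_reflection v x \<bullet> y = x \<bullet> hyperplane_reflection v y"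
  by (metis hyperplane_reflection_involutive inner_hyperplane_reflection)

text \<open>The formula of a reflection uses only linear operations and inner products, both of
  which \<open>f\<close> preserves.\<close>

lemma hyperplane_reflection_conjugate:
  assumes "linear f" and "\<And>x y. f x \<bullet> f y = x \<bullet> y"
  shows "f (hyperplane_reflection v x) = hyperplane_reflection (f v) (f x)"
  using assms by (simp add: hyperplane_reflection_def linear_diff linear_scale)

lemma orthogonal_transformation_hyperplane_reflection:
  "orthogonal_transformation (hyperplane_reflection v)"
  by (simp add: orthogonal_transformation_def linear_hyperplane_reflection inner_hyperplane_reflection)

text \<open>A reflection negates its normal, so evaluating both maps at \<open>v\<close> makes
  \<open>v\<close> a multiple of \<open>w\<close>. This bounds the number of unit normals of one
  reflection by two.\<close>

lemma hyperplane_reflection_unit_inj: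
  assumes "norm v = 1" "norm w = 1" "hyperplane_reflection v = hyperplane_reflection w"
  shows "w = v \<or> w = - v"
proof -
  have "- v = v - (2 * (w \<bullet> v)) *\<^sub>R w"
    using assms by (metis hyperplane_reflection_self hyperplane_reflection_unit)
  then have "2 *\<^sub>R v = 2 *\<^sub>R ((w \<bullet> v) *\<^sub>R w)"
    by (simp add: algebra_simps scaleR_2)
  then have *: "v = (w \<bullet> v) *\<^sub>R w"
    by (metis scaleR_left_imp_eq zero_neq_numeral)
  then have "\<bar>w \<bullet> v\<bar> = 1"
    using assms by (metis norm_scaleR mult.right_neutral)
  then show ?thesis
    using * by (smt (verit) scaleR_one scaleR_minus1_left minus_minus)
qed

text \<open>A word is a list of normals. With \<open>foldr\<close> the last letter acts first, and
  appending lists composes the maps.\<close>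

lemma linear_word: "linear (foldr hyperplane_reflection as)"
proof (induction as)
  case Nil
  then show ?case by (simp add: linear_id[unfolded id_def] id_def)
next
  case (Cons a as)
  then show ?case
    using linear_compose[OF Cons linear_hyperplane_reflection, of a] by (simp add: comp_def)
qed

lemma inner_word:
  "foldr hyperplane_reflection as x \<bullet> foldr hyperplane_reflection as y = x \<bullet> y"
  by (induction as) (simp_all add: inner_hyperplane_reflection)

section \<open>Simple roots\<close>

text \<open>A finite root system normalised to unit vectors, so that each mirror has exactly the two
  normals \<open>v\<close> and \<open>- v\<close>, with a point \<open>p\<close> off all mirrors
  that decides signs.\<close>

locale regular_root_set =
  fixes \<Phi> :: "(real^'n) set" and p :: "real^'n"
  assumes finite_roots: "finite \<Phi>"
    and norm_root: "v \<in> \<Phi> \<Longrightarrow> norm v = 1"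
    and reflection_root: "v \<in> \<Phi> \<Longrightarrow> w \<in> \<Phi> \<Longrightarrow> hyperplane_reflection v w \<in> \<Phi>"
    and regular: "v \<in> \<Phi> \<Longrightarrow> v \<bullet> p \<noteq> 0"
begin

definition pos :: "(real^'n) set" where
  "pos = {v \<in> \<Phi>. 0 < v \<bullet> p}"

text \<open>Instead of indecomposability or a basis condition, simplicity is the property that the
  deletion argument uses: the reflection makes no positive root negative except its own.\<close>

definition simple :: "(real^'n) set" where
  "simple = {a \<in> pos. \<forall>b\<in>pos. b \<noteq> a \<longrightarrow> hyperplane_reflection a b \<in> pos}"

text \<open>The closed Weyl chamber around \<open>p\<close>. Using all positive roots gives the sign
  at a chamber point of any root, simple or not.\<close>

definition chamber :: "(real^'n) set" where
  "chamber = {x. \<forall>v\<in>pos. 0 \<le> v \<bullet> x}"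

lemma minus_root: "v \<in> \<Phi> \<Longrightarrow> - v \<in> \<Phi>"
  using reflection_root[of v v] by (simp add: hyperplane_reflection_self)

lemma not_pos_iff: "v \<in> \<Phi> \<Longrightarrow> v \<notin> pos \<longleftrightarrow> - v \<in> pos"
  using regular[of v] by (auto simp: pos_def minus_root)

lemma pos_root: "v \<in> pos \<Longrightarrow> v \<in> \<Phi>"
  by (simp add: pos_def)

lemma simple_pos: "a \<in> simple \<Longrightarrow> a \<in> pos"
  by (simp add: simple_def)

lemma finite_pos: "finite pos"
  by (simp add: pos_def finite_roots)

text \<open>If a positive root \<open>b\<close> minimising first \<open>b \<bullet> q / b \<bullet> p\<close> and then \<open>b \<bullet> p\<close> were not simple, a
  multiple \<open>c b\<close> with \<open>c < 2\<close> would be a sum of two positive roots, which are then again minimal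
  for the ratio, and one of them has a smaller product with \<open>p\<close>.\<close>

lemma exists_negative_simple_root:
  assumes "b \<in> pos" "b \<bullet> q < 0"
  shows "\<exists>a\<in>simple. a \<bullet> q < 0"
proof -
  define r where "r v = (v \<bullet> q) / (v \<bullet> p)" for v
  define m where "m = Min (r ` pos)"
  have m_le: "m \<le> r v" if "v \<in> pos" for v
    unfolding m_def using that finite_pos by simp
  have "m \<in> r ` pos"
    unfolding m_def using assms finite_pos by (intro Min_in) auto
  then obtain a0 where a0: "a0 \<in> pos" "r a0 = m"
    by auto
  define M where "M = {v \<in> pos. r v = m}"
  have "finite M" "M \<noteq> {}"
    using a0 finite_pos by (auto simp: M_def)
  then obtain a where a: "a \<in> M" and a_min: "\<And>v. v \<in> M \<Longrightarrow> a \<bullet> p \<le> v \<bullet> p"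
    using ex_is_arg_min_if_finite[of M "\<lambda>v. v \<bullet> p"] by (auto simp: is_arg_min_linorder)
  have apos: "a \<in> pos" and ra: "r a = m"
    using a by (auto simp: M_def)
  have pp: "0 < v \<bullet> p" if "v \<in> pos" for v
    using that by (simp add: pos_def)
  have rq: "v \<bullet> q = r v * (v \<bullet> p)" if "v \<in> pos" for v
    using pp[OF that] by (simp add: r_def)
  have "m < 0"
    using m_le[OF assms(1)] assms(2) pp[OF assms(1)] by (smt (verit) r_def divide_neg_pos)
  then have aq: "a \<bullet> q < 0"
    using rq[OF apos] pp[OF apos] ra by (simp add: mult_neg_pos)
  have "hyperplane_reflection a g \<in> pos" if g: "g \<in> pos" "g \<noteq> a" for g
  proof (rule ccontr)
    assume "hyperplane_reflection a g \<notin> pos"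
    define h where "h = - hyperplane_reflection a g"
    have h: "h \<in> pos"
      unfolding h_def using \<open>hyperplane_reflection a g \<notin> pos\<close> g apos
      by (metis not_pos_iff pos_root reflection_root)
    define c where "c = 2 * (a \<bullet> g)"
    have sum: "g + h = c *\<^sub>R a"
      unfolding h_def c_def using norm_root[OF pos_root[OF apos]]
      by (simp add: hyperplane_reflection_unit)
    have "c < 2"
    proof -
      have n: "norm a = 1" "norm g = 1"
        using norm_root pos_root apos g by auto
      have "0 < (a - g) \<bullet> (a - g)"
        using g by simp
      also have "\<dots> = 2 - c"
        using n by (simp add: c_def inner_diff_left inner_diff_right norm_eq_1 inner_commute)
      finally show ?thesis by simp
    qed
    have sp: "g \<bullet> p + h \<bullet> p = c * (a \<bullet> p)" and sq: "g \<bullet> q + h \<bullet> q = c * (a \<bullet> q)"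
      using arg_cong[OF sum, of "\<lambda>x. x \<bullet> p"] arg_cong[OF sum, of "\<lambda>x. x \<bullet> q"]
      by (simp_all add: inner_add_left)
    \<comment> \<open>The ratio of \<open>g + h\<close> is a weighted mean of the ratios of
      \<open>g\<close> and \<open>h\<close>. It equals the minimum \<open>m\<close>, so both ratios
      do.\<close>
    have "g \<bullet> q + h \<bullet> q = m * (g \<bullet> p) + m * (h \<bullet> p)"
      using sp sq rq[OF apos] ra by (simp add: algebra_simps flip: distrib_left)
    moreover have "g \<bullet> q \<ge> m * (g \<bullet> p)" "h \<bullet> q \<ge> m * (h \<bullet> p)"
      using rq m_le pp g(1) h by (simp_all add: mult_right_mono)
    ultimately have "g \<bullet> q = m * (g \<bullet> p)" "h \<bullet> q = m * (h \<bullet> p)"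
      by linarith+
    then have "g \<in> M" "h \<in> M"
      using g(1) h pp[OF g(1)] pp[OF h] by (auto simp: M_def r_def)
    then have "2 * (a \<bullet> p) \<le> c * (a \<bullet> p)"
      using a_min[of g] a_min[of h] sp by linarith
    then show False
      using \<open>c < 2\<close> pp[OF apos] by simp
  qed
  then have "a \<in> simple"
    using apos by (simp add: simple_def)
  with aq show ?thesis ..
qed

section \<open>Words in simple reflections\<close>

lemma word_root: "set as \<subseteq> \<Phi> \<Longrightarrow> v \<in> \<Phi> \<Longrightarrow> foldr hyperplane_reflection as v \<in> \<Phi>"
  by (induction as) (auto simp: reflection_root)

lemma simple_root: "a \<in> simple \<Longrightarrow> a \<in> \<Phi>"
  by (simp add: simple_pos pos_root)

text \<open>Induction on the height \<open>b \<bullet> p\<close>, measured by counting lower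
  positive roots. As \<open>b\<close> is negative on \<open>- b\<close>, some simple
  \<open>a\<close> has \<open>a \<bullet> b > 0\<close>. Unless \<open>a = b\<close>, reflecting
  \<open>b\<close> in \<open>a\<close> gives a lower positive root \<open>c\<close>, and conjugating
  the reflection of \<open>c\<close> by that of \<open>a\<close> gives the reflection of
  \<open>b\<close>.\<close>

lemma pos_reflection_generated:
  assumes "b \<in> pos"
  shows "\<exists>as. set as \<subseteq> simple \<and> foldr hyperplane_reflection as = hyperplane_reflection b"
  using assms
proof (induction "card {v \<in> pos. v \<bullet> p < b \<bullet> p}" arbitrary: b rule: less_induct)
  case less
  have "b \<bullet> (- b) < 0"
    using norm_root[OF pos_root[OF less.prems]] by (simp add: norm_eq_1)
  then obtain a where a: "a \<in> simple" "a \<bullet> b > 0"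
    using exists_negative_simple_root[OF less.prems, of "- b"] by auto
  show ?case
  proof (cases "a = b")
    case True
    then show ?thesis
      using a by (intro exI[of _ "[a]"]) auto
  next
    case False
    define c where "c = hyperplane_reflection a b"
    have c: "c \<in> pos"
      using a False less.prems by (simp add: c_def simple_def)
    have "c \<bullet> p = b \<bullet> p - 2 * (a \<bullet> b) * (a \<bullet> p)"
      using norm_root[OF simple_root[OF a(1)]]
      by (simp add: c_def hyperplane_reflection_unit inner_diff_left)
    moreover have "a \<bullet> p > 0"
      using simple_pos[OF a(1)] by (simp add: pos_def)
    ultimately have lt: "c \<bullet> p < b \<bullet> p"
      using a by simp
    \<comment> \<open>The inclusion is strict because \<open>c\<close> itself is counted only on the
      right.\<close>
    have "card {v \<in> pos. v \<bullet> p < c \<bullet> p} < card {v \<in> pos. v \<bullet> p < b \<bullet> p}"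
      using finite_pos c lt by (intro psubset_card_mono) auto
    then obtain as where as: "set as \<subseteq> simple"
        "foldr hyperplane_reflection as = hyperplane_reflection c"
      using less.hyps c by blast
    have "hyperplane_reflection a (hyperplane_reflection c (hyperplane_reflection a x))
        = hyperplane_reflection b x" for x
      using hyperplane_reflection_conjugate[OF linear_hyperplane_reflection inner_hyperplane_reflection,
          of a c "hyperplane_reflection a x"]
      by (simp add: hyperplane_reflection_involutive c_def)
    then have "foldr hyperplane_reflection (a # as @ [a]) = hyperplane_reflection b"
      by (auto simp: as(2))
    then show ?thesis
      using a as(1) by (intro exI[of _ "a # as @ [a]"]) auto
  qed
qed

text \<open>Follow \<open>b\<close> through the word from the last letter. It starts positive and
  ends negative, so some letter turns it negative, and a simple letter does that only to itself.
  Conjugation moves the reflection of \<open>b\<close> next to that letter, where the two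
  cancel.\<close>

lemma deletion:
  assumes "set as \<subseteq> simple" "b \<in> pos" "foldr hyperplane_reflection as b \<notin> pos"
  shows "\<exists>bs. set bs \<subseteq> simple \<and> length bs < length as \<and>
    (\<forall>x. foldr hyperplane_reflection as (hyperplane_reflection b x) = foldr hyperplane_reflection bs x)"
  using assms
proof (induction as)
  case Nil
  then show ?case by simp
next
  case (Cons a as)
  let ?w = "foldr hyperplane_reflection as"
  show ?case
  proof (cases "?w b \<in> pos")
    case True
    then have "?w b = a"
      using Cons.prems by (auto simp: simple_def)
    then have "?w (hyperplane_reflection b x) = hyperplane_reflection a (?w x)" for x
      using hyperplane_reflection_conjugate[OF linear_word inner_word, of as b x] by simp
    then show ?thesis
      using Cons.prems by (intro exI[of _ as]) (auto simp: hyperplane_reflection_involutive)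
  next
    case False
    then obtain bs where "set bs \<subseteq> simple" "length bs < length as"
        "\<forall>x. ?w (hyperplane_reflection b x) = foldr hyperplane_reflection bs x"
      using Cons by auto
    then show ?thesis
      using Cons.prems by (intro exI[of _ "a # bs"]) auto
  qed
qed

lemma chamber_word_unique:
  assumes "set as \<subseteq> simple" "x \<in> chamber" "foldr hyperplane_reflection as x \<in> chamber"
  shows "foldr hyperplane_reflection as x = x"
  using assms
proof (induction "length as" arbitrary: as rule: less_induct)
  case less
  show ?case
  proof (cases as rule: rev_cases)
    case Nil
    then show ?thesis by simp
  next
    case (snoc as' a)
    let ?w = "foldr hyperplane_reflection as'"
    have a: "a \<in> simple" and as': "set as' \<subseteq> simple"
      using less.prems(1) snoc by auto
    have eq: "foldr hyperplane_reflection as y = ?w (hyperplane_reflection a y)" for y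
      using snoc by simp
    have root: "?w a \<in> \<Phi>"
      using word_root as' a simple_root by blast
    show ?thesis
    proof (cases "?w a \<in> pos")
      case True
      \<comment> \<open>The image of \<open>x\<close> lies in the chamber, so its product with the
        positive root \<open>?w a\<close> is nonnegative. Pulled back along \<open>?w\<close>, this
        product is \<open>- (a \<bullet> x)\<close>, which puts \<open>x\<close> on the mirror of
        \<open>a\<close>.\<close>
      have "?w a \<bullet> ?w (hyperplane_reflection a x) = a \<bullet> hyperplane_reflection a x"
        by (rule inner_word)
      also have "\<dots> = - (a \<bullet> x)"
        by (simp add: hyperplane_reflection_self flip: inner_hyperplane_reflection_left)
      finally have "a \<bullet> x \<le> 0"
        using True less.prems(3) unfolding eq chamber_def by fastforce
      moreover have "0 \<le> a \<bullet> x"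
        using less.prems(2) simple_pos[OF a] by (simp add: chamber_def)
      ultimately have "hyperplane_reflection a x = x"
        by (simp add: hyperplane_reflection_orthogonal)
      then show ?thesis
        using less.hyps[of as'] less.prems as' snoc by simp
    next
      case False
      then obtain bs where "set bs \<subseteq> simple" "length bs < length as'"
          "\<forall>x. ?w (hyperplane_reflection a x) = foldr hyperplane_reflection bs x"
        using deletion[OF as' simple_pos[OF a]] by blast
      then show ?thesis
        using less.hyps[of bs] less.prems snoc by simp
    qed
  qed
qed

end

section \<open>Finite orthogonal groups\<close>

lemma inner_orthogonal_matrix:
  fixes A :: "real^'n^'n"
  assumes "orthogonal_matrix A"
  shows "(A *v x) \<bullet> (A *v y) = x \<bullet> y"
  using assms orthogonal_transformation_matrix[of "(*v) A"]
  by (simp add: orthogonal_transformation_def)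

lemma transpose_orthogonal_matrix_vector:
  fixes A :: "real^'n^'n"
  assumes "orthogonal_matrix A"
  shows "transpose A *v (A *v x) = x" "A *v (transpose A *v x) = x"
  using assms by (metis matrix_vector_mul_assoc matrix_vector_mul_lid orthogonal_matrix_def)+

lemma orthogonal_matrix_hyperplane_reflection:
  "orthogonal_matrix (matrix (hyperplane_reflection v))"
  using orthogonal_transformation_hyperplane_reflection orthogonal_transformation_matrix by blast

text \<open>The transpose is the inverse, and a reflection is its own inverse.\<close>

lemma transpose_hyperplane_reflection:
  "transpose (matrix (hyperplane_reflection v)) = matrix (hyperplane_reflection v)"
proof -
  have "transpose (matrix (hyperplane_reflection v)) *v x = matrix (hyperplane_reflection v) *v x" for x
    using transpose_orthogonal_matrix_vector(1)[OF orthogonal_matrix_hyperplane_reflection,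
        of v "hyperplane_reflection v x"]
    by (simp add: matrix_hyperplane_reflection hyperplane_reflection_involutive)
  then show ?thesis
    by (simp add: matrix_eq)
qed

lemma inv_orthogonal_group:
  assumes "orthogonal_matrix A"
  shows "inv\<^bsub>orthogonal_group\<^esub> A = transpose A"
  using assms
  by (intro group.inv_equality[OF group_orthogonal_group])
    (auto simp: orthogonal_group_def orthogonal_matrix_def)

text \<open>An isometry fixing the hyperplane preserves the line through \<open>a\<close>, so it
  scales \<open>a\<close> by 1 or -1, and 1 would give the identity.\<close>

lemma orthogonal_matrix_fixing_hyperplane:
  fixes A :: "real^'n^'n"
  assumes A: "orthogonal_matrix A" "A \<noteq> mat 1"
    and "a \<noteq> 0" and fixed: "\<And>x. a \<bullet> x = 0 \<Longrightarrow> A *v x = x"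
  shows "A = matrix (hyperplane_reflection a)"
proof -
  \<comment> \<open>\<open>c\<close> is the coefficient of the projection of \<open>A *v a\<close>
    onto \<open>a\<close>, and \<open>d\<close> is the remainder. \<open>d\<close> lies in the fixed
    hyperplane, whence it is orthogonal to \<open>A *v a\<close> as well and vanishes.\<close>
  define c where "c = (a \<bullet> (A *v a)) / (a \<bullet> a)"
  define d where "d = A *v a - c *\<^sub>R a"
  have ad: "a \<bullet> d = 0"
    using \<open>a \<noteq> 0\<close> by (simp add: d_def c_def inner_diff_right)
  have "(A *v a) \<bullet> d = 0"
    using inner_orthogonal_matrix[OF A(1), of a d] fixed[OF ad] ad by simp
  moreover have "d \<bullet> d = (A *v a) \<bullet> d - c * (a \<bullet> d)"
    by (metis d_def inner_diff_left inner_scaleR_left)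
  ultimately have "d \<bullet> d = 0"
    using ad by simp
  then have Aa: "A *v a = c *\<^sub>R a"
    by (simp add: d_def)
  have "c * c * (a \<bullet> a) = a \<bullet> a"
    using inner_orthogonal_matrix[OF A(1), of a a] by (simp add: Aa)
  then have "c * c = 1"
    using \<open>a \<noteq> 0\<close> by simp
  then have c: "c = 1 \<or> c = - 1"
    using square_eq_1_iff by blast
  have Ax: "A *v x = x + ((c - 1) * ((a \<bullet> x) / (a \<bullet> a))) *\<^sub>R a" for x
  proof -
    let ?t = "(a \<bullet> x) / (a \<bullet> a)"
    have "a \<bullet> (x - ?t *\<^sub>R a) = 0"
      using \<open>a \<noteq> 0\<close> by (simp add: inner_diff_right)
    from fixed[OF this] have "A *v x - ?t *\<^sub>R (A *v a) = x - ?t *\<^sub>R a"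
      by (simp add: matrix_vector_mult_diff_distrib matrix_vector_mult_scaleR)
    then show ?thesis
      by (simp add: Aa algebra_simps diff_divide_distrib)
  qed
  have "c \<noteq> 1"
    using A(2) Ax by (auto simp: matrix_eq)
  with c have "c = - 1"
    by simp
  then show ?thesis
    by (simp add: matrix_eq matrix_hyperplane_reflection Ax hyperplane_reflection_def)
qed

section \<open>Facts from convex geometry\<close>

text \<open>In a minimal description by halfspaces every bounding hyperplane cuts out a facet, and
  \<open>y\<close> violates one of the halfspaces. Nonempty interior makes the affine hull the whole
  space, so that no other constraint can exclude \<open>y\<close>.\<close>

lemma polyhedron_facet_halfspaces:
  fixes S :: "'a::euclidean_space set"
  assumes "polyhedron S" "interior S \<noteq> {}" "y \<notin> S"
  obtains a b where "a \<noteq> 0" "(S \<inter> {x. a \<bullet> x = b}) facet_of S" "\<And>x. x \<in> interior S \<Longrightarrow> a \<bullet> x < b"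
    "b < a \<bullet> y"
proof -
  obtain H where "finite H" and S: "S = affine hull S \<inter> \<Inter>H"
    and H: "\<forall>h\<in>H. \<exists>a b. a \<noteq> 0 \<and> h = {x. a \<bullet> x \<le> b}"
    and min: "\<And>H'. H' \<subset> H \<Longrightarrow> S \<subset> affine hull S \<inter> \<Inter>H'"
    using assms(1) by (simp add: polyhedron_Int_affine_minimal) meson
  obtain a b where ab: "\<And>h. h \<in> H \<Longrightarrow> a h \<noteq> 0 \<and> h = {x. a h \<bullet> x \<le> b h}"
    using H by metis
  have "affine hull S = UNIV"
    using assms(2) by (rule affine_hull_nonempty_interior)
  then obtain h where h: "h \<in> H" "y \<notin> h"
    using S assms(3) by auto
  have hs: "a h \<noteq> 0" "h = {x. a h \<bullet> x \<le> b h}"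
    using ab h by auto
  show thesis
  proof
    show "(S \<inter> {x. a h \<bullet> x = b h}) facet_of S"
      using facet_of_polyhedron_explicit[OF \<open>finite H\<close> S ab min] h(1) by blast
    show "a h \<bullet> x < b h" if "x \<in> interior S" for x
    proof -
      have "S \<subseteq> {x. a h \<bullet> x \<le> b h}"
        using S h(1) hs(2) by blast
      from interior_mono[OF this] show ?thesis
        using that hs(1) by (auto simp: interior_halfspace_le)
    qed
    show "b h < a h \<bullet> y"
      using h(2) hs(2) by auto
  qed (fact hs(1))
qed

text \<open>A convex set with nonempty interior lies in the closure of its interior.\<close>

lemma halfspace_of_interior:
  fixes S :: "'a::euclidean_space set"
  assumes "convex S" "interior S \<noteq> {}" "\<And>x. x \<in> interior S \<Longrightarrow> a \<bullet> x \<le> b" "x \<in> S"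
  shows "a \<bullet> x \<le> b"
proof -
  have "closure (interior S) \<subseteq> {x. a \<bullet> x \<le> b}"
    using assms(3) by (intro closure_minimal closed_halfspace_le) auto
  then show ?thesis
    using assms closure_subset convex_closure_interior by blast
qed

text \<open>Finitely many hyperplanes form a null set. This supplies a point off all
  mirrors.\<close>

lemma ex_not_orthogonal:
  fixes A :: "'a::euclidean_space set"
  assumes "finite A" "0 \<notin> A"
  shows "\<exists>x. \<forall>a\<in>A. a \<bullet> x \<noteq> 0"
proof (rule ccontr)
  assume "\<not> ?thesis"
  then have "UNIV = \<Union>((\<lambda>a. {x. a \<bullet> x = 0}) ` A)"
    by auto
  moreover have "negligible (\<Union>((\<lambda>a. {x. a \<bullet> x = 0}) ` A))"
    using assms by (intro negligible_Union) (auto intro!: negligible_hyperplane)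
  ultimately show False
    by (metis non_negligible_UNIV)
qed

locale finite_orthogonal_group =
  fixes G :: "(real^'n^'n) set"
  assumes subgroup: "subgroup G orthogonal_group" and finite: "finite G"
begin

lemma orthogonal: "g \<in> G \<Longrightarrow> orthogonal_matrix g"
  using subgroup.subset[OF subgroup] by (auto simp: orthogonal_group_def)

lemma one_closed: "mat 1 \<in> G"
  using subgroup.one_closed[OF subgroup] by (simp add: orthogonal_group_def)

lemma mult_closed: "g \<in> G \<Longrightarrow> h \<in> G \<Longrightarrow> g ** h \<in> G"
  using subgroup.m_closed[OF subgroup] by (simp add: orthogonal_group_def)

lemma transpose_closed: "g \<in> G \<Longrightarrow> transpose g \<in> G"
  using subgroup.m_inv_closed[OF subgroup] inv_orthogonal_group[OF orthogonal] by metis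

lemma inj: "g \<in> G \<Longrightarrow> inj ((*v) g)"
  by (metis injI orthogonal transpose_orthogonal_matrix_vector(1))

lemma interior_translate: "g \<in> G \<Longrightarrow> interior (translate g F) = translate g (interior F)"
  unfolding translate_def by (rule interior_injective_linear_image) (simp_all add: inj)

lemma mem_translate_iff: "g \<in> G \<Longrightarrow> x \<in> translate g F \<longleftrightarrow> transpose g *v x \<in> F"
  unfolding translate_def
  by (metis (no_types, lifting) image_iff orthogonal transpose_orthogonal_matrix_vector)

lemma translate_one: "translate (mat 1) F = F"
  by (simp add: translate_def)

lemma convex_translate: "convex F \<Longrightarrow> convex (translate g F)"
  unfolding translate_def by (rule convex_linear_image) simp_all

subsection \<open>Fundamental domains\<close>

text \<open>A convex set with empty interior is null, and finitely many null translates cannot cover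
  the space.\<close>

lemma interior_fundamental_domain_nonempty:
  assumes "fundamental_domain G F"
  shows "interior F \<noteq> {}"
proof
  assume "interior F = {}"
  have "convex F" and cover: "(\<Union>g\<in>G. translate g F) = UNIV"
    using assms by (auto simp: fundamental_domain_def)
  have "negligible (translate g F)" if "g \<in> G" for g
    using \<open>interior F = {}\<close> that
    by (simp add: negligible_convex_interior convex_translate \<open>convex F\<close> interior_translate)
      (simp add: translate_def)
  then have "negligible (\<Union>g\<in>G. translate g F)"
    using finite by (intro negligible_Union) auto
  then show False
    unfolding cover by simp
qed

text \<open>The disjoint convex interiors of \<open>F\<close> and its translate are separated by a
  hyperplane, and the weak inequalities extend to the sets themselves.\<close>

lemma fundamental_domain_separation:
  assumes F: "fundamental_domain G F" and g: "g \<in> G" "g \<noteq> mat 1"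
  shows "\<exists>a b. a \<noteq> 0 \<and> (\<forall>x\<in>F. a \<bullet> x \<le> b) \<and> (\<forall>x\<in>translate g F. b \<le> a \<bullet> x)"
proof -
  have "convex F" and ne: "interior F \<noteq> {}"
    using F interior_fundamental_domain_nonempty by (auto simp: fundamental_domain_def)
  have ne': "interior (translate g F) \<noteq> {}"
    using ne g by (simp add: interior_translate) (simp add: translate_def)
  have "interior (translate g F) \<inter> interior (translate (mat 1) F) = {}"
    using F g one_closed by (auto simp: fundamental_domain_def disjoint_family_on_def)
  then have "interior F \<inter> interior (translate g F) = {}"
    by (auto simp: translate_one)
  then obtain a b where "a \<noteq> 0" and le: "\<forall>x\<in>interior F. a \<bullet> x \<le> b"
    and ge: "\<forall>x\<in>interior (translate g F). b \<le> a \<bullet> x"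
    using separating_hyperplane_sets[OF convex_interior[OF \<open>convex F\<close>]
        convex_interior[OF convex_translate[OF \<open>convex F\<close>]] ne ne'] by blast
  have "\<forall>x\<in>F. a \<bullet> x \<le> b"
    using halfspace_of_interior[OF \<open>convex F\<close> ne] le by blast
  moreover have "\<forall>x\<in>translate g F. b \<le> a \<bullet> x"
    using halfspace_of_interior[OF convex_translate[OF \<open>convex F\<close>] ne', of "- a" "- b"] ge by simp
  ultimately show ?thesis
    using \<open>a \<noteq> 0\<close> by blast
qed

text \<open>\<open>P\<close> is the intersection of the halfspaces that separate \<open>F\<close>
  from its other translates. An interior point of \<open>P\<close> is strictly on the side of
  \<open>F\<close>, so the translate that covers it can only be \<open>F\<close>; taking closures
  gives \<open>P \<subseteq> F\<close>.\<close>

lemma polyhedron_fundamental_domain: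
  assumes F: "fundamental_domain G F"
  shows "polyhedron F"
proof -
  have "closed F" and cover: "(\<Union>g\<in>G. translate g F) = UNIV" and ne: "interior F \<noteq> {}"
    using F interior_fundamental_domain_nonempty by (auto simp: fundamental_domain_def)
  obtain a b where ab: "\<And>g. g \<in> G - {mat 1} \<Longrightarrow>
      a g \<noteq> 0 \<and> (\<forall>x\<in>F. a g \<bullet> x \<le> b g) \<and> (\<forall>x\<in>translate g F. b g \<le> a g \<bullet> x)"
    using fundamental_domain_separation[OF F] by (metis DiffE singletonI)
  define P where "P = \<Inter>((\<lambda>g. {x. a g \<bullet> x \<le> b g}) ` (G - {mat 1}))"
  have poly: "polyhedron P"
    unfolding P_def using finite by (intro polyhedron_Inter) (auto simp: polyhedron_halfspace_le)
  have "F \<subseteq> P"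
    using ab by (auto simp: P_def)
  have "interior P \<subseteq> F"
  proof
    fix x assume x: "x \<in> interior P"
    obtain g where g: "g \<in> G" "x \<in> translate g F"
      using cover by blast
    have "g = mat 1"
    proof (rule ccontr)
      assume "g \<noteq> mat 1"
      then have "g \<in> G - {mat 1}"
        using g by simp
      then have "P \<subseteq> {x. a g \<bullet> x \<le> b g}"
        unfolding P_def by blast
      from interior_mono[OF this] have "a g \<bullet> x < b g"
        using x ab[OF \<open>g \<in> G - {mat 1}\<close>] by (auto simp: interior_halfspace_le)
      then show False
        using ab[OF \<open>g \<in> G - {mat 1}\<close>] g(2) by force
    qed
    then show "x \<in> F"
      using g by (simp add: translate_one)
  qed
  moreover have "interior P \<noteq> {}"
    using interior_mono[OF \<open>F \<subseteq> P\<close>] ne by blast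
  ultimately have "P \<subseteq> F"
    using closure_minimal[of "interior P" F] \<open>closed F\<close> closure_subset[of P]
      convex_closure_interior[OF polyhedron_imp_convex[OF poly]] by simp
  then show ?thesis
    using poly \<open>F \<subseteq> P\<close> by (simp add: subset_antisym)
qed

section \<open>From an exact domain to a reflection group\<close>

lemma eq_of_card_orbit:
  assumes card: "\<forall>X\<in>orbits G. card (F \<inter> X) = 1"
    and "g \<in> G" "x \<in> F" "g *v x \<in> F"
  shows "g *v x = x"
proof -
  let ?X = "{g *v x | g. g \<in> G}"
  have "card (F \<inter> ?X) = 1"
    using card by (auto simp: orbits_def)
  then obtain z where z: "F \<inter> ?X = {z}"
    by (auto simp: card_1_singleton_iff)
  have "x \<in> F \<inter> ?X"
    using assms one_closed by (auto intro!: exI[of _ "mat 1"])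
  moreover have "g *v x \<in> F \<inter> ?X"
    using assms by auto
  ultimately show ?thesis
    unfolding z by simp
qed

text \<open>The fixed space \<open>V\<close> of \<open>g\<close> is a proper linear subspace
  containing the facet, so a dimension count makes it the hyperplane spanned by the facet. Being
  linear, \<open>V\<close> contains 0, which gives \<open>b = 0\<close>.\<close>

lemma exact_imp_facet_reflection:
  assumes F: "exact_fundamental_domain G F"
    and card: "\<forall>X\<in>orbits G. card (F \<inter> X) = 1"
    and "a \<noteq> 0" and facet: "(F \<inter> {x. a \<bullet> x = b}) facet_of F"
  shows "b = 0 \<and> matrix (hyperplane_reflection a) \<in> G"
proof -
  let ?S = "F \<inter> {x. a \<bullet> x = b}"
  have fd: "fundamental_domain G F"
    using F by (simp add: exact_fundamental_domain_def)
  obtain g where g: "g \<in> G" and S: "?S = F \<inter> translate g F"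
    using F facet by (auto simp: exact_fundamental_domain_def)
  \<comment> \<open>The identity would give \<open>?S = F\<close>, but a facet is a proper
    face.\<close>
  have "g \<noteq> mat 1"
    using facet S facet_of_irrefl by (force simp: translate_one)
  define V where "V = {x. g *v x = x}"
  have "subspace V"
    by (auto simp: V_def subspace_def matrix_vector_right_distrib matrix_vector_mult_scaleR)
  then have "affine V"
    by (rule subspace_imp_affine)
  have "?S \<subseteq> V"
  proof
    fix x assume "x \<in> ?S"
    then have "x \<in> F" "transpose g *v x \<in> F"
      using S g by (auto simp: mem_translate_iff)
    then have "transpose g *v x = x"
      using eq_of_card_orbit[OF card transpose_closed[OF g]] by blast
    then show "x \<in> V"
      unfolding V_def using transpose_orthogonal_matrix_vector(2)[OF orthogonal[OF g], of x] by simp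
  qed
  have dimS: "aff_dim ?S = DIM(real^'n) - 1"
    using facet interior_fundamental_domain_nonempty[OF fd]
    by (simp add: facet_of_def aff_dim_nonempty_interior)
  have ne: "?S \<noteq> {}"
    using facet by (auto simp: facet_of_def)
  have hull: "affine hull ?S = {x. a \<bullet> x = b}"
    using ne dimS \<open>a \<noteq> 0\<close> hull_minimal[of ?S "{x. a \<bullet> x = b}" affine]
    by (intro affine_dim_equal) (simp_all add: affine_hyperplane)
  have "V \<noteq> UNIV"
    using \<open>g \<noteq> mat 1\<close> by (auto simp: V_def matrix_eq)
  then have "aff_dim V < DIM(real^'n)"
    by (metis \<open>affine V\<close> affine_hull_eq aff_dim_eq_full aff_dim_le_DIM order_le_less)
  then have "affine hull ?S = V"
    using ne dimS \<open>affine V\<close> hull_minimal[of ?S V affine] \<open>?S \<subseteq> V\<close> aff_dim_subset[OF \<open>?S \<subseteq> V\<close>]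
    by (intro affine_dim_equal) simp_all
  with hull have V: "V = {x. a \<bullet> x = b}"
    by simp
  have "0 \<in> V"
    by (simp add: V_def)
  then have "b = 0"
    by (simp add: V)
  moreover have "g *v x = x" if "a \<bullet> x = 0" for x
    using that V \<open>b = 0\<close> by (auto simp: V_def)
  then have "g = matrix (hyperplane_reflection a)"
    using orthogonal_matrix_fixing_hyperplane[OF orthogonal[OF g] \<open>g \<noteq> mat 1\<close> \<open>a \<noteq> 0\<close>] by blast
  ultimately show ?thesis
    using g by simp
qed

lemma exact_imp_reflection_group:
  assumes F: "exact_fundamental_domain G F"
    and card: "\<forall>X\<in>orbits G. card (F \<inter> X) = 1"
  shows "reflection_group G"
proof -
  interpret O: group "orthogonal_group :: (real^'n^'n) monoid"
    by (rule group_orthogonal_group)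
  have fd: "fundamental_domain G F"
    using F by (simp add: exact_fundamental_domain_def)
  define W where "W = generate orthogonal_group (reflections \<inter> G)"
  have "reflections \<inter> G \<subseteq> carrier orthogonal_group"
    using subgroup.subset[OF subgroup] by blast
  then have Wsub: "subgroup W orthogonal_group"
    unfolding W_def by (rule O.generate_is_subgroup)
  have "W \<subseteq> G"
    unfolding W_def using subgroup by (intro O.generate_subgroup_incl) auto
  interpret W: finite_orthogonal_group W
    using Wsub finite_subset[OF \<open>W \<subseteq> G\<close> finite] by (rule finite_orthogonal_group.intro)
  obtain p where p: "p \<in> interior F"
    using interior_fundamental_domain_nonempty[OF fd] by blast
  have "g \<in> W" if g: "g \<in> G" for g
  proof -
    obtain w where w: "w \<in> W"
      and max: "\<And>u. u \<in> W \<Longrightarrow> (u *v (g *v p)) \<bullet> p \<le> (w *v (g *v p)) \<bullet> p"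
    proof -
      have "finite ((\<lambda>w. (w *v (g *v p)) \<bullet> p) ` W)" "(\<lambda>w. (w *v (g *v p)) \<bullet> p) ` W \<noteq> {}"
        using W.finite W.one_closed by auto
      from Max_in[OF this] Max_ge[OF this(1)] show thesis
        by (auto intro: that)
    qed
    define y where "y = w *v (g *v p)"
    have wg: "w ** g \<in> G"
      using w \<open>W \<subseteq> G\<close> g mult_closed by blast
    have y: "y = (w ** g) *v p"
      by (simp add: y_def matrix_vector_mul_assoc)
    have "y \<in> F"
    proof (rule ccontr)
      assume "y \<notin> F"
      then obtain a b where a: "a \<noteq> 0" "(F \<inter> {x. a \<bullet> x = b}) facet_of F"
          "\<And>x. x \<in> interior F \<Longrightarrow> a \<bullet> x < b" "b < a \<bullet> y"
        using polyhedron_facet_halfspaces[OF polyhedron_fundamental_domain[OF fd]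
            interior_fundamental_domain_nonempty[OF fd]] by metis
      then have b: "b = 0" and r: "matrix (hyperplane_reflection a) \<in> G"
        using exact_imp_facet_reflection[OF F card] by auto
      then have "matrix (hyperplane_reflection a) \<in> W"
        unfolding W_def using a(1) by (intro generate.incl) (auto simp: reflections_def)
      then have "hyperplane_reflection a y \<bullet> p \<le> y \<bullet> p"
        using max[OF W.mult_closed[OF _ w]] unfolding y_def
        by (metis matrix_hyperplane_reflection matrix_vector_mul_assoc)
      then have "0 \<le> (a \<bullet> y) * (a \<bullet> p) / (a \<bullet> a)"
        by (simp add: hyperplane_reflection_def inner_diff_left)
      \<comment> \<open>The mirror of \<open>a\<close> separates \<open>y\<close> from
        \<open>p\<close>, so reflecting \<open>y\<close> brings it closer to \<open>p\<close>,
        against the choice of \<open>w\<close>.\<close>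
      moreover have "(a \<bullet> y) * (a \<bullet> p) < 0"
        using a(3)[OF p] a(4) b by (simp add: mult_pos_neg)
      ultimately show False
        using a(1) by (smt (verit) divide_neg_pos inner_gt_zero_iff)
    qed
    then have "y = p"
      using eq_of_card_orbit[OF card wg] p interior_subset y by blast
    \<comment> \<open>Since \<open>w ** g\<close> fixes \<open>p\<close>, the interiors of
      \<open>F\<close> and of its translate by \<open>w ** g\<close> share \<open>p\<close>.\<close>
    then have "p \<in> interior (translate (w ** g) F)"
      using p y interior_translate[OF wg] by (metis image_eqI translate_def)
    then have "w ** g = mat 1"
      using fd p wg one_closed
      by (force simp: fundamental_domain_def disjoint_family_on_def translate_one)
    then have "g = transpose w"
      by (metis W.orthogonal matrix_mul_assoc matrix_mul_lid matrix_mul_rid orthogonal_matrix_def w)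
    then show ?thesis
      using W.transpose_closed[OF w] by simp
  qed
  then have "G = W"
    using \<open>W \<subseteq> G\<close> by blast
  then show ?thesis
    unfolding reflection_group_def W_def by blast
qed

end

section \<open>Reflection groups\<close>

text \<open>The matrix form of conjugation shows that the roots of a group are closed under their
  own reflections.\<close>

lemma matrix_hyperplane_reflection_conjugate:
  "matrix (hyperplane_reflection (hyperplane_reflection v w)) =
    matrix (hyperplane_reflection v) ** matrix (hyperplane_reflection w) ** matrix (hyperplane_reflection v)"
proof -
  have "hyperplane_reflection (hyperplane_reflection v w) x =
      hyperplane_reflection v (hyperplane_reflection w (hyperplane_reflection v x))" for x
    using hyperplane_reflection_conjugate[OF linear_hyperplane_reflection inner_hyperplane_reflection,
        of v w "hyperplane_reflection v x"]
    by (simp add: hyperplane_reflection_involutive)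
  then show ?thesis
    by (simp add: matrix_eq matrix_hyperplane_reflection flip: matrix_vector_mul_assoc)
qed

section \<open>The roots of the group and words for its elements\<close>

context finite_orthogonal_group
begin

text \<open>Both unit normals of each mirror belong to the set, as a root system requires.\<close>

definition roots :: "(real^'n) set" where
  "roots = {v. norm v = 1 \<and> matrix (hyperplane_reflection v) \<in> G}"

lemma root_reflection: "v \<in> roots \<Longrightarrow> matrix (hyperplane_reflection v) \<in> G"
  by (simp add: roots_def)

text \<open>Each of the finitely many group elements is the reflection of at most two unit
  vectors.\<close>

lemma finite_roots: "finite roots"
proof -
  let ?R = "\<lambda>g. {v. norm v = 1 \<and> matrix (hyperplane_reflection v) = g}"
  have "finite (?R g)" for g
  proof (cases "?R g = {}")
    case False
    then obtain v where v: "norm v = 1" "matrix (hyperplane_reflection v) = g"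
      by blast
    have "?R g \<subseteq> {v, - v}"
    proof
      fix w assume "w \<in> ?R g"
      then have w: "norm w = 1" "matrix (hyperplane_reflection w) = g"
        by auto
      have "hyperplane_reflection v = hyperplane_reflection w"
        using v(2) w(2) by (metis ext matrix_hyperplane_reflection)
      then show "w \<in> {v, - v}"
        using hyperplane_reflection_unit_inj[OF v(1) w(1)] by blast
    qed
    then show ?thesis
      using finite_subset by blast
  qed (simp only: finite.emptyI)
  then have "finite (\<Union>g\<in>G. ?R g)"
    using finite by blast
  then show ?thesis
    by (rule rev_finite_subset) (auto simp: roots_def)
qed

lemma ex_regular_root_set: "\<exists>p. regular_root_set roots p"
proof -
  obtain p where "\<forall>v\<in>roots. v \<bullet> p \<noteq> 0"
    using ex_not_orthogonal[OF finite_roots] by (auto simp: roots_def)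
  moreover have "hyperplane_reflection v w \<in> roots" if "v \<in> roots" "w \<in> roots" for v w
  proof -
    have "norm (hyperplane_reflection v w) = norm w"
      by (simp add: norm_eq_sqrt_inner inner_hyperplane_reflection)
    then show ?thesis
      using that by (simp add: roots_def matrix_hyperplane_reflection_conjugate mult_closed)
  qed
  ultimately show ?thesis
    using finite_roots by (intro exI[of _ p] regular_root_set.intro) (auto simp: roots_def)
qed

text \<open>Scaling the normal to length one and choosing its sign gives a positive root with the
  same reflection.\<close>

lemma reflections_subset_word:
  assumes "regular_root_set roots p" and "r \<in> reflections" "r \<in> G"
  shows "\<exists>as. set as \<subseteq> regular_root_set.simple roots p \<and> (*v) r = foldr hyperplane_reflection as"
proof -
  interpret regular_root_set roots p by fact
  obtain v where v: "v \<noteq> 0" "r = matrix (hyperplane_reflection v)"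
    using assms(2) by (auto simp: reflections_def)
  define u where "u = inverse (norm v) *\<^sub>R v"
  have hu: "hyperplane_reflection u = hyperplane_reflection v"
    using v by (simp add: u_def hyperplane_reflection_scale)
  then have "u \<in> roots"
    using v assms(3) by (simp add: u_def roots_def)
  then consider "u \<in> pos" | "- u \<in> pos"
    using not_pos_iff by blast
  then obtain as where "set as \<subseteq> simple" "foldr hyperplane_reflection as = hyperplane_reflection u"
    using pos_reflection_generated hyperplane_reflection_minus by metis
  moreover have "(*v) r = hyperplane_reflection v"
    by (rule ext) (simp add: v matrix_hyperplane_reflection)
  ultimately show ?thesis
    using hu by metis
qed

text \<open>Induction over the generated group: generators have words, reflections are their own
  inverses, and products concatenate words.\<close>

lemma reflection_group_word:
  assumes "regular_root_set roots p" and "reflection_group G" and "g \<in> G"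
  shows "\<exists>as. set as \<subseteq> regular_root_set.simple roots p \<and> (*v) g = foldr hyperplane_reflection as"
proof -
  obtain R where R: "R \<subseteq> reflections" and G: "G = generate orthogonal_group R"
    using assms(2) by (auto simp: reflection_group_def)
  have RG: "r \<in> G" if "r \<in> R" for r
    using that G by (simp add: generate.incl)
  have "g \<in> generate orthogonal_group R"
    using assms(3) G by simp
  then show ?thesis
  proof induction
    case one
    then show ?case
      by (intro exI[of _ "[]"]) (auto simp: orthogonal_group_def)
  next
    case (incl r)
    then show ?case
      using R RG reflections_subset_word[OF assms(1)] by blast
  next
    case (inv r)
    then obtain v where "r = matrix (hyperplane_reflection v)"
      using R by (auto simp: reflections_def)
    then have "inv\<^bsub>orthogonal_group\<^esub> r = r"
      by (simp add: inv_orthogonal_group orthogonal_matrix_hyperplane_reflection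
          transpose_hyperplane_reflection)
    then show ?case
      using inv R RG reflections_subset_word[OF assms(1), of r] by auto
  next
    case (eng g h)
    then obtain as bs where "set as \<subseteq> regular_root_set.simple roots p" "(*v) g = foldr hyperplane_reflection as"
      "set bs \<subseteq> regular_root_set.simple roots p" "(*v) h = foldr hyperplane_reflection bs"
      by blast
    moreover have "(*v) (g \<otimes>\<^bsub>orthogonal_group\<^esub> h) = (*v) g \<circ> (*v) h"
      by (auto simp: orthogonal_group_def matrix_vector_mul_assoc)
    ultimately show ?case
      by (intro exI[of _ "as @ bs"]) auto
  qed
qed

section \<open>The chamber as an exact fundamental domain\<close>

lemma chamber_unique:
  assumes "regular_root_set roots p" and "reflection_group G" and "g \<in> G"
    and "x \<in> regular_root_set.chamber roots p" "g *v x \<in> regular_root_set.chamber roots p"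
  shows "g *v x = x"
  using reflection_group_word[OF assms(1-3)] regular_root_set.chamber_word_unique[OF assms(1)] assms(4,5)
  by metis

text \<open>Choose the orbit point with the largest product with \<open>p\<close>. If a positive
  root were negative there, its reflection would increase that product.\<close>

lemma chamber_covers:
  assumes "regular_root_set roots p"
  shows "\<exists>g\<in>G. g *v x \<in> regular_root_set.chamber roots p"
proof -
  interpret regular_root_set roots p by fact
  let ?f = "\<lambda>g. (g *v x) \<bullet> p"
  have "finite (?f ` G)" "?f ` G \<noteq> {}"
    using finite one_closed by auto
  from Max_in[OF this] Max_ge[OF this(1)]
  obtain g where g: "g \<in> G" and max: "\<And>h. h \<in> G \<Longrightarrow> ?f h \<le> ?f g"
    by auto
  have "0 \<le> v \<bullet> (g *v x)" if v: "v \<in> pos" for v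
  proof -
    have "matrix (hyperplane_reflection v) ** g \<in> G"
      using v g by (simp add: mult_closed pos_root root_reflection)
    from max[OF this] have "hyperplane_reflection v (g *v x) \<bullet> p \<le> (g *v x) \<bullet> p"
      by (simp add: matrix_hyperplane_reflection flip: matrix_vector_mul_assoc)
    then have "0 \<le> (v \<bullet> (g *v x)) * (v \<bullet> p)"
      using norm_root[OF pos_root[OF v]]
      by (simp add: hyperplane_reflection_unit inner_diff_left mult.commute)
    then show ?thesis
      using v by (simp add: pos_def zero_le_mult_iff)
  qed
  then show ?thesis
    using g by (auto simp: chamber_def)
qed

text \<open>On a common open part of two translates the inverses of \<open>g\<close> and
  \<open>h\<close> agree by uniqueness in the chamber. Linear maps that agree on a nonempty open set
  are equal.\<close>

lemma fundamental_domain_chamber: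
  assumes p: "regular_root_set roots p" and "reflection_group G"
  shows "fundamental_domain G (regular_root_set.chamber roots p)"
proof -
  interpret regular_root_set roots p by fact
  have C: "chamber = \<Inter>((\<lambda>v. {x. 0 \<le> v \<bullet> x}) ` pos)"
    by (auto simp: chamber_def)
  have "closed chamber"
    unfolding C by (auto intro!: closed_Inter closed_halfspace_ge)
  moreover have "convex chamber"
    unfolding C by (auto intro!: convex_Inter convex_halfspace_ge)
  moreover have "\<exists>g\<in>G. x \<in> translate g chamber" for x
  proof -
    obtain g where "g \<in> G" "g *v x \<in> chamber"
      using chamber_covers[OF p] by blast
    then show ?thesis
      using transpose_closed[of g] mem_translate_iff[of "transpose g"]
      by (intro bexI[of _ "transpose g"]) auto
  qed
  moreover have "interior (translate g chamber) \<inter> interior (translate h chamber) = {}"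
    if gh: "g \<in> G" "h \<in> G" "g \<noteq> h" for g h
  proof (rule ccontr)
    let ?U = "interior (translate g chamber) \<inter> interior (translate h chamber)"
    assume "?U \<noteq> {}"
    define k where "k = transpose h ** g"
    have k: "k \<in> G"
      using gh by (simp add: k_def mult_closed transpose_closed)
    have fixed: "transpose h *v x = transpose g *v x" if "x \<in> ?U" for x
    proof -
      have x: "transpose g *v x \<in> chamber" "transpose h *v x \<in> chamber"
        using that interior_subset gh mem_translate_iff by blast+
      have "k *v (transpose g *v x) = transpose h *v x"
        using transpose_orthogonal_matrix_vector(2)[OF orthogonal[OF gh(1)]]
        unfolding k_def by (metis matrix_vector_mul_assoc)
      then show ?thesis
        using chamber_unique[OF p assms(2) k x(1)] x(2) by simp
    qed
    \<comment> \<open>\<open>V\<close> is a subspace containing the nonempty open set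
      \<open>?U\<close>, so it is the whole space.\<close>
    define V where "V = {x. (transpose h - transpose g) *v x = 0}"
    have "subspace V"
      by (auto simp: V_def subspace_def matrix_vector_right_distrib matrix_vector_mult_scaleR
          simp del: transpose_matrix_vector)
    moreover have "?U \<subseteq> V"
      using fixed by (auto simp: V_def matrix_vector_mult_diff_rdistrib)
    then have "interior V \<noteq> {}"
      using \<open>?U \<noteq> {}\<close> interior_maximal[of ?U V] by blast
    ultimately have "V = UNIV"
      using affine_hull_nonempty_interior[of V]
      by (simp add: subspace_imp_affine affine_hull_eq[THEN iffD2])
    then have "transpose h = transpose g"
      by (auto simp: V_def matrix_eq matrix_vector_mult_diff_rdistrib)
    then show False
      using gh(3) by (metis transpose_transpose)
  qed
  ultimately show ?thesis
    unfolding fundamental_domain_def disjoint_family_on_def by blast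
qed

text \<open>A relative interior point \<open>z\<close> of the facet is not interior to the chamber,
  so some positive root \<open>v\<close> vanishes at \<open>z\<close>. The face \<open>?T\<close> on
  its mirror then contains \<open>S\<close>. It misses \<open>p\<close>, so its dimension is at most
  that of \<open>S\<close>, and the two coincide.\<close>

lemma facet_of_chamber:
  assumes p: "regular_root_set roots p" and S: "S facet_of regular_root_set.chamber roots p"
  shows "\<exists>v\<in>regular_root_set.pos roots p. S = regular_root_set.chamber roots p \<inter> {x. v \<bullet> x = 0}"
proof -
  interpret regular_root_set roots p by fact
  have cv: "convex chamber"
    by (auto simp: chamber_def convex_def inner_add_right)
  have face: "S face_of chamber" and "S \<noteq> {}" "S \<noteq> chamber"
    using S facet_of_irrefl by (auto simp: facet_of_def)
  then obtain z where z: "z \<in> rel_interior S"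
    using rel_interior_eq_empty face_of_imp_convex by blast
  then have zS: "z \<in> S"
    using rel_interior_subset by blast
  then have zC: "z \<in> chamber"
    using face face_of_imp_subset by blast
  have "\<exists>v\<in>pos. v \<bullet> z = 0"
  proof (rule ccontr)
    assume "\<not> ?thesis"
    then have "z \<in> (\<Inter>v\<in>pos. {x. 0 < v \<bullet> x})"
      using zC by (force simp: chamber_def)
    moreover have "open (\<Inter>v\<in>pos. {x. 0 < v \<bullet> x})"
      using finite_pos by (auto intro: open_halfspace_gt)
    moreover have "(\<Inter>v\<in>pos. {x. 0 < v \<bullet> x}) \<subseteq> chamber"
      by (auto simp: chamber_def less_imp_le)
    ultimately have "z \<in> interior chamber"
      by (meson interiorI)
    then show False
      using face_of_disjoint_interior[OF face \<open>S \<noteq> chamber\<close>] zS by blast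
  qed
  then obtain v where v: "v \<in> pos" "v \<bullet> z = 0"
    by blast
  let ?T = "chamber \<inter> {x. v \<bullet> x = 0}"
  have T: "?T face_of chamber"
    using v cv by (intro face_of_Int_supporting_hyperplane_ge) (auto simp: chamber_def)
  have "S \<subseteq> ?T"
    using z zC v by (intro subset_of_face_of[OF T face_of_imp_subset[OF face]]) auto
  then have ST: "S face_of ?T"
    by (rule face_of_subset[OF face _ face_of_imp_subset[OF T]])
  have "p \<in> chamber" "p \<notin> ?T"
    using v by (auto simp: chamber_def pos_def)
  then have "aff_dim ?T < aff_dim chamber"
    using face_of_aff_dim_lt[OF cv T] by blast
  then have "aff_dim ?T \<le> aff_dim S"
    using S by (simp add: facet_of_def)
  then have "S = ?T"
    using face_of_aff_dim_lt[OF face_of_imp_convex[OF T] ST] by force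
  then show ?thesis
    using v by blast
qed

lemma reflection_group_imp_exact:
  assumes "reflection_group G"
  shows "\<exists>F. exact_fundamental_domain G F \<and> (\<forall>X\<in>orbits G. card (F \<inter> X) = 1)"
proof -
  obtain p where p: "regular_root_set roots p"
    using ex_regular_root_set by blast
  interpret regular_root_set roots p by fact
  have "\<exists>g\<in>G. S = chamber \<inter> translate g chamber" if S: "S facet_of chamber" for S
  proof -
    obtain v where v: "v \<in> pos" and S: "S = chamber \<inter> {x. v \<bullet> x = 0}"
      using facet_of_chamber[OF p S] by blast
    \<comment> \<open>The witness for exactness is the reflection in the mirror of the facet. If
      \<open>x\<close> and its reflection are both in the chamber, then \<open>v \<bullet> x\<close>
      and its negative are nonnegative.\<close>
    let ?r = "matrix (hyperplane_reflection v)"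
    have r: "?r \<in> G"
      using v by (simp add: pos_root root_reflection)
    have mem: "x \<in> translate ?r chamber \<longleftrightarrow> hyperplane_reflection v x \<in> chamber" for x
      unfolding mem_translate_iff[OF r] transpose_hyperplane_reflection
      by (simp only: matrix_hyperplane_reflection)
    have "v \<bullet> x = 0" if "x \<in> chamber" "hyperplane_reflection v x \<in> chamber" for x
    proof -
      have "0 \<le> v \<bullet> x" "0 \<le> v \<bullet> hyperplane_reflection v x"
        using that v by (auto simp: chamber_def)
      then show ?thesis
        by (simp add: hyperplane_reflection_self flip: inner_hyperplane_reflection_left)
    qed
    then have "S = chamber \<inter> translate ?r chamber"
      by (auto simp: S mem hyperplane_reflection_orthogonal)
    with r show ?thesis ..
  qed
  then have exact: "exact_fundamental_domain G chamber"
    using fundamental_domain_chamber[OF p assms] by (simp add: exact_fundamental_domain_def)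
  have "card (chamber \<inter> X) = 1" if orb: "X \<in> orbits G" for X
  proof -
    obtain x where X: "X = {g *v x | g. g \<in> G}"
      using orb unfolding orbits_def by blast
    obtain g where g: "g \<in> G" "g *v x \<in> chamber"
      using chamber_covers[OF p] by blast
    have uniq: "h *v x = g *v x" if h: "h \<in> G" "h *v x \<in> chamber" for h
    proof -
      \<comment> \<open>This writes one chamber point as the image of the other under a group
        element, the form that \<open>chamber_unique\<close> requires.\<close>
      have eq: "(h ** transpose g) *v (g *v x) = h *v x"
        using transpose_orthogonal_matrix_vector(1)[OF orthogonal[OF g(1)]]
        by (metis matrix_vector_mul_assoc)
      have "h ** transpose g \<in> G"
        using g h by (simp add: mult_closed transpose_closed)
      from chamber_unique[OF p assms this g(2)] show ?thesis
        unfolding eq using h(2) by blast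
    qed
    have "y = g *v x" if y: "y \<in> chamber \<inter> X" for y
    proof -
      obtain h where "h \<in> G" "y = h *v x"
        using y unfolding X by blast
      with uniq[of h] y show ?thesis
        by blast
    qed
    moreover have "g *v x \<in> chamber \<inter> X"
      using g unfolding X by blast
    ultimately have "chamber \<inter> X = {g *v x}"
      by blast
    then show ?thesis
      by simp
  qed
  with exact show ?thesis
    by blast
qed

end

theorem theorem6:
  fixes G :: "(real^'n^'n) set"
  assumes "subgroup G orthogonal_group"
    and "finite G"
  shows "(\<exists>F. exact_fundamental_domain G F \<and> (\<forall>X\<in>orbits G. card (F \<inter> X) = 1))
         \<longleftrightarrow> reflection_group G"
proof -
  interpret finite_orthogonal_group G
    using assms by (rule finite_orthogonal_group.intro)
  show ?thesis
    using exact_imp_reflection_group reflection_group_imp_exact by blast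
qed

end
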